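(* Let $G$ and $H$ be graphs with adjacency matrices $A_G$ and $A_H$ and coherent algebras $\mathcal A_G$ and $\mathcal A_H$ respectively. Then $G\cong_{\mathcal{DNN}}H$ if and only if there exists an isomorphism of coherent algebras $\phi:\mathcal A_G\to\mathcal A_H$ with $\phi(A_G)=A_H$.
   Context: Graphs are finite, simple and undirected. For vertices $x,y$ of the same graph, $\mathrm{rel}(x,y)$ denotes their relationship: equal, adjacent, or distinct non-adjacent. $\mathcal{DNN}$ is the cone of doubly nonnegative matrices, i.e. positive semidefinite matrices with (real) nonnegative entries. $G\cong_{\mathcal{DNN}}H$ means: there is a matrix $M\in\mathcal{DNN}$ with rows and columns indexed by $V_G\times V_H$ such that $\sum_{h,h'\in V_H}M_{gh,g'h'}=1$ for all $g,g'\in V_G$; $\sum_{g,g'\in V_G}M_{gh,g'h'}=1$ for all $h,h'\in V_H$; and $M_{gh,g'h'}=0$ whenever $\mathrm{rel}(g,g')\neq\mathrm{rel}(h,h')$. A coherent algebra is a linear subspace of $\mathbb C^{n\times n}$ that is closed under matrix multiplication, contains the identity $I$ and the all-ones matrix $J$, is closed under Schur (entrywise) product $\bullet$, and is closed under conjugate transpose. The coherent algebra $\mathcal A_G$ of a graph $G$ is the intersection of all coherent algebras containing $A_G$. An isomorphism of coherent algebras $\mathcal A\to\mathcal B$ is a linear bijection $\phi$ with $\phi(M^\dagger)=\phi(M)^\dagger$, $\phi(MN)=\phi(M)\phi(N)$ and $\phi(M\bullet N)=\phi(M)\bullet\phi(N)$ for all $M,N\in\mathcal A$. *)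

theory Defs
  imports "HOL-Analysis.Analysis"
begin

section \<open>Graphs and DNN-isomorphism\<close>

text \<open>The vertex set of a graph is the universe of a finite type; the graph is given by its
  adjacency relation.\<close>

definition simple_graph :: "('a::finite \<Rightarrow> 'a \<Rightarrow> bool) \<Rightarrow> bool" where
  "simple_graph G \<longleftrightarrow> symp G \<and> irreflp G"

definition adj_matrix :: "('a::finite \<Rightarrow> 'a \<Rightarrow> bool) \<Rightarrow> complex^'a^'a" where
  "adj_matrix G = (\<chi> x y. if G x y then 1 else 0)"

datatype relationship = Equal | Adjacent | Nonadjacent

definition rel :: "('a \<Rightarrow> 'a \<Rightarrow> bool) \<Rightarrow> 'a \<Rightarrow> 'a \<Rightarrow> relationship" where
  "rel G x y = (if x = y then Equal else if G x y then Adjacent else Nonadjacent)"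

definition pos_semidef :: "real^'n^'n \<Rightarrow> bool" where
  "pos_semidef M \<longleftrightarrow> transpose M = M \<and> (\<forall>v. 0 \<le> v \<bullet> (M *v v))"

definition doubly_nonneg :: "(real^'n^'n) set" where
  "doubly_nonneg = {M. pos_semidef M \<and> (\<forall>i j. 0 \<le> M $ i $ j)}"

definition dnn_isomorphic ::
    "('g::finite \<Rightarrow> 'g \<Rightarrow> bool) \<Rightarrow> ('h::finite \<Rightarrow> 'h \<Rightarrow> bool) \<Rightarrow> bool" where
  "dnn_isomorphic G H \<longleftrightarrow>
     (\<exists>M :: real^('g \<times> 'h)^('g \<times> 'h). M \<in> doubly_nonneg \<and>
        (\<forall>g g'. (\<Sum>h\<in>UNIV. \<Sum>h'\<in>UNIV. M $ (g, h) $ (g', h')) = 1) \<and>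
        (\<forall>h h'. (\<Sum>g\<in>UNIV. \<Sum>g'\<in>UNIV. M $ (g, h) $ (g', h')) = 1) \<and>
        (\<forall>g h g' h'. rel G g g' \<noteq> rel H h h' \<longrightarrow> M $ (g, h) $ (g', h') = 0))"


section \<open>Coherent algebras\<close>

definition smult_matrix :: "complex \<Rightarrow> complex^'n^'n \<Rightarrow> complex^'n^'n" where
  "smult_matrix c M = (\<chi> i j. c * M $ i $ j)"

text \<open>The library has no complex vector space structure on matrix types, only the real one.\<close>

lemma vector_space_smult_matrix: "vector_space smult_matrix"
  by unfold_locales (simp_all add: smult_matrix_def vec_eq_iff algebra_simps)

definition all_ones :: "complex^'n^'n" where
  "all_ones = (\<chi> i j. 1)"

definition schur_product :: "complex^'n^'n \<Rightarrow> complex^'n^'n \<Rightarrow> complex^'n^'n" where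
  "schur_product M N = (\<chi> i j. M $ i $ j * N $ i $ j)"

definition conj_transpose :: "complex^'n^'n \<Rightarrow> complex^'n^'n" where
  "conj_transpose M = (\<chi> i j. cnj (M $ j $ i))"

definition coherent_algebra :: "(complex^'n^'n) set \<Rightarrow> bool" where
  "coherent_algebra A \<longleftrightarrow>
     module.subspace smult_matrix A \<and>
     (\<forall>M\<in>A. \<forall>N\<in>A. M ** N \<in> A) \<and>
     mat 1 \<in> A \<and>
     all_ones \<in> A \<and>
     (\<forall>M\<in>A. \<forall>N\<in>A. schur_product M N \<in> A) \<and>
     (\<forall>M\<in>A. conj_transpose M \<in> A)"

definition graph_coherent_algebra ::
    "('a::finite \<Rightarrow> 'a \<Rightarrow> bool) \<Rightarrow> (complex^'a^'a) set" where
  "graph_coherent_algebra G = \<Inter> {A. coherent_algebra A \<and> adj_matrix G \<in> A}"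

text \<open>Only the restriction of \<open>\<phi>\<close> to \<open>A\<close> matters; its values outside \<open>A\<close> are arbitrary.\<close>

definition coherent_algebra_iso ::
    "(complex^'m^'m) set \<Rightarrow> (complex^'n^'n) set \<Rightarrow> (complex^'m^'m \<Rightarrow> complex^'n^'n) \<Rightarrow> bool" where
  "coherent_algebra_iso A B \<phi> \<longleftrightarrow>
     bij_betw \<phi> A B \<and>
     (\<forall>M\<in>A. \<forall>N\<in>A. \<phi> (M + N) = \<phi> M + \<phi> N) \<and>
     (\<forall>c. \<forall>M\<in>A. \<phi> (smult_matrix c M) = smult_matrix c (\<phi> M)) \<and>
     (\<forall>M\<in>A. \<phi> (conj_transpose M) = conj_transpose (\<phi> M)) \<and>
     (\<forall>M\<in>A. \<forall>N\<in>A. \<phi> (M ** N) = \<phi> M ** \<phi> N) \<and>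
     (\<forall>M\<in>A. \<forall>N\<in>A. \<phi> (schur_product M N) = schur_product (\<phi> M) (\<phi> N))"

end

(* The DNN matrix M is the Choi matrix of the map X |-> Y, Y_hh' = sum_gg' M_gh,g'h' X_gg'. As M is
   entrywise nonnegative, this map is an averaging in the entries, and the extreme case of Jensen's
   inequality makes it multiplicative for the Schur product on the X linked to Y by: X_gg' = Y_hh'
   wherever M_gh,g'h' is nonzero. As M is positive semidefinite, the map is completely positive, and
   the extreme case of the Schwarz inequality makes it multiplicative for the matrix product on the
   same X. So the linked pairs form the graph of an isomorphism between coherent algebras, and
   (A_G, A_H) is linked.

   Conversely, let A_i be the minimal Schur idempotents of the coherent algebra of G, with n_i ones,
   and B_i their images. The matrix M = sum_i (A_i (x) B_i) / n_i has the required entries and sums,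
   and (X (x) 1) M = (1 (x) phi(X)^T) M for all X in the algebra. Hence M^2 = D M with
   D = 1 (x) sum_i B_i B_i^T / n_i positive definite and commuting with M, so M is positive
   semidefinite. *)

theory Submission
  imports Defs
begin

section \<open>Sums over finite types\<close>

lemma sum_zero_imp_zero:
  fixes f :: "'a::finite \<Rightarrow> real"
  assumes "\<And>i. 0 \<le> f i" "(\<Sum>i\<in>UNIV. f i) = 0"
  shows "f i = 0"
  using sum_nonneg_eq_0_iff[of UNIV f] assms by auto

lemma sum_UNIV_single:
  fixes f :: "'a::finite \<Rightarrow> 'b::comm_monoid_add"
  assumes "\<And>i. i \<noteq> k \<Longrightarrow> f i = 0"
  shows "(\<Sum>i\<in>UNIV. f i) = f k"
  using assms by (subst sum.remove[of UNIV k]) (auto intro: sum.neutral)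

lemma sum_UNIV_prod:
  "(\<Sum>i\<in>(UNIV :: ('a::finite \<times> 'b::finite) set). f i) = (\<Sum>a\<in>UNIV. \<Sum>b\<in>UNIV. f (a, b))"
  unfolding UNIV_Times_UNIV[symmetric] by (simp add: sum.cartesian_product)

lemma sum_rotate:
  "(\<Sum>a\<in>A. \<Sum>b\<in>B. \<Sum>c\<in>C. f a b c) = (\<Sum>c\<in>C. \<Sum>a\<in>A. \<Sum>b\<in>B. f a b c)"
proof -
  have "(\<Sum>b\<in>B. \<Sum>c\<in>C. f a b c) = (\<Sum>c\<in>C. \<Sum>b\<in>B. f a b c)" for a
    by (rule sum.swap)
  then show ?thesis
    by (simp add: sum.swap[of _ A C])
qed

lemma sum_reorder:
  "(\<Sum>a\<in>A. \<Sum>b\<in>B. \<Sum>c\<in>C. \<Sum>d\<in>D. f a b c d) = (\<Sum>c\<in>C. \<Sum>d\<in>D. \<Sum>a\<in>A. \<Sum>b\<in>B. f a b c d)"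
  unfolding sum_rotate[where f = "\<lambda>a b c. \<Sum>d\<in>D. f a b c d"]
  by (intro sum.cong refl sum_rotate)

section \<open>The isomorphism given by a DNN matrix\<close>

text \<open>The vector \<open>w\<close> minimises the quadratic form, so the first variation in the
  direction \<open>M *v w\<close> vanishes.\<close>

lemma pos_semidef_kernel:
  fixes M :: "real^'n^'n"
  assumes M: "pos_semidef M" and 0: "w \<bullet> (M *v w) = 0"
  shows "M *v w = 0"
proof -
  define u where "u = M *v w"
  define c where "c = u \<bullet> (M *v u)"
  have c: "0 \<le> c"
    using M by (simp add: pos_semidef_def c_def)
  have sym: "w \<bullet> (M *v u) = u \<bullet> u"
    using M by (metis dot_lmul_matrix u_def vector_transpose_matrix pos_semidef_def)
  have *: "0 \<le> 2 * t * (u \<bullet> u) + t\<^sup>2 * c" for t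
  proof -
    have "0 \<le> (w + t *\<^sub>R u) \<bullet> (M *v (w + t *\<^sub>R u))"
      using M by (simp add: pos_semidef_def)
    also have "\<dots> = 2 * t * (u \<bullet> u) + t\<^sup>2 * c"
      using 0 sym
      by (simp add: matrix_vector_right_distrib matrix_vector_mult_scaleR inner_add_left
          inner_add_right c_def power2_eq_square distrib_left flip: u_def)
    finally show ?thesis .
  qed
  have "u \<bullet> u \<le> 0"
  proof (rule ccontr)
    assume "\<not> u \<bullet> u \<le> 0"
    then have pos: "0 < u \<bullet> u" by linarith
    \<comment> \<open>Near the minimiser \<open>- (u \<bullet> u) / c\<close>; the added 1 also
      covers \<open>c = 0\<close>.\<close>
    define t where "t = - (u \<bullet> u) / (1 + c)"
    have "2 * t * (u \<bullet> u) + t\<^sup>2 * c = - (u \<bullet> u)\<^sup>2 * (2 + c) / (1 + c)\<^sup>2"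
      using c by (simp add: t_def field_simps power2_eq_square add_nonneg_eq_0_iff)
    also have "\<dots> < 0"
      using pos c by (intro divide_neg_pos mult_neg_pos) auto
    finally show False using *[of t] by simp
  qed
  then show ?thesis
    using inner_gt_zero_iff[of u] u_def by (metis not_less)
qed

text \<open>Of the zero pattern only the diagonal part enters here; adjacency comes in later, as one
  linked pair in \<open>coherent_algebra_iso_of_linked\<close>.\<close>

locale dnn_isomorphism =
  fixes M :: "real^('g::finite \<times> 'h::finite)^('g \<times> 'h)"
  assumes psd: "pos_semidef M"
    and nonneg: "0 \<le> M $ i $ j"
    and sum_right: "(\<Sum>h\<in>UNIV. \<Sum>h'\<in>UNIV. M $ (g, h) $ (g', h')) = 1"
    and sum_left: "(\<Sum>g\<in>UNIV. \<Sum>g'\<in>UNIV. M $ (g, h) $ (g', h')) = 1"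
    and diag: "M $ (g, h) $ (g', h') \<noteq> 0 \<Longrightarrow> g = g' \<longleftrightarrow> h = h'"
begin

lemma sym: "M $ i $ j = M $ j $ i"
  using psd by (simp add: pos_semidef_def transpose_def vec_eq_iff del: split_paired_All)

section \<open>Linked pairs and intertwined pairs\<close>

definition linked :: "('g \<Rightarrow> 'g \<Rightarrow> 'c) \<Rightarrow> ('h \<Rightarrow> 'h \<Rightarrow> 'c) \<Rightarrow> bool" where
  "linked x y \<longleftrightarrow> (\<forall>g h g' h'. M $ (g, h) $ (g', h') \<noteq> 0 \<longrightarrow> x g g' = y h h')"

lemma linked_transpose: "linked x y \<Longrightarrow> linked (\<lambda>g g'. x g' g) (\<lambda>h h'. y h' h)"
  by (auto simp: linked_def sym[of "(_, _)" "(_, _)"])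

lemma linked_mult:
  fixes x :: "'g \<Rightarrow> 'g \<Rightarrow> real"
  assumes "linked x y"
  shows "M $ (g, h) $ (g', h') * x g g' = M $ (g, h) $ (g', h') * y h h'"
  using assms by (auto simp: linked_def)

lemma support_left: "\<exists>g g'. M $ (g, h) $ (g', h') \<noteq> 0"
proof (rule ccontr)
  assume "\<not> ?thesis"
  then show False
    using sum_left[of h h'] by simp
qed

lemma support_right: "\<exists>h h'. M $ (g, h) $ (g', h') \<noteq> 0"
proof (rule ccontr)
  assume "\<not> ?thesis"
  then show False
    using sum_right[of g g'] by simp
qed

lemma linked_unique_right: "linked x y \<Longrightarrow> linked x y' \<Longrightarrow> y h h' = y' h h'"
  using support_left[of h h'] by (auto simp: linked_def)

lemma linked_unique_left: "linked x y \<Longrightarrow> linked x' y \<Longrightarrow> x g g' = x' g g'"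
  using support_right[of g g'] by (auto simp: linked_def)

text \<open>This makes the map X |-> Y unital: \<open>diag\<close> reduces the sum over all pairs,
  which is 1, to its diagonal. The next lemma says likewise that the map preserves traces.\<close>

lemma sum_diag_left: "(\<Sum>g\<in>UNIV. M $ (g, h) $ (g, h')) = (if h = h' then 1 else 0)"
proof (cases "h = h'")
  case True
  have "(\<Sum>g'\<in>UNIV. M $ (g, h) $ (g', h)) = M $ (g, h) $ (g, h)" for g
    using diag[of g h _ h] by (intro sum_UNIV_single) auto
  then show ?thesis
    using True sum_left[of h h] by simp
next
  case False
  then show ?thesis
    using diag by (auto intro!: sum.neutral)
qed

lemma sum_diag_right: "(\<Sum>h\<in>UNIV. M $ (g, h) $ (g', h)) = (if g = g' then 1 else 0)"
proof (cases "g = g'")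
  case True
  have "(\<Sum>h'\<in>UNIV. M $ (g, h) $ (g, h')) = M $ (g, h) $ (g, h)" for h
    using diag[of g h g _] by (intro sum_UNIV_single) auto
  then show ?thesis
    using True sum_right[of g g] by simp
next
  case False
  then show ?thesis
    using diag by (auto intro!: sum.neutral)
qed

lemma sum_weighted_left:
  "(\<Sum>g\<in>UNIV. \<Sum>g'\<in>UNIV. \<Sum>h\<in>UNIV. \<Sum>h'\<in>UNIV. M $ (g, h) $ (g', h') * x g g')
     = (\<Sum>g\<in>UNIV. \<Sum>g'\<in>UNIV. x g g')"
  by (simp add: sum_right flip: sum_distrib_right)

lemma sum_weighted_right:
  "(\<Sum>g\<in>UNIV. \<Sum>g'\<in>UNIV. \<Sum>h\<in>UNIV. \<Sum>h'\<in>UNIV. M $ (g, h) $ (g', h') * y h h')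
     = (\<Sum>h\<in>UNIV. \<Sum>h'\<in>UNIV. y h h')"
  by (subst sum_reorder) (simp add: sum_left flip: sum_distrib_right)

text \<open>Weighted by \<open>M\<close>, both sums agree term by term on its support. Applied to
  squares, this equates Frobenius norms.\<close>

lemma linked_sum:
  fixes x :: "'g \<Rightarrow> 'g \<Rightarrow> real"
  assumes "linked x y"
  shows "(\<Sum>g\<in>UNIV. \<Sum>g'\<in>UNIV. x g g') = (\<Sum>h\<in>UNIV. \<Sum>h'\<in>UNIV. y h h')"
  using sum_weighted_left[of x] sum_weighted_right[of y] by (simp add: linked_mult[OF assms])

text \<open>If \<open>M = \<Sum>\<^sub>k v\<^sub>k v\<^sub>k\<^sup>T\<close> and \<open>K\<^sub>k\<close> is \<open>v\<^sub>k\<close> read as an \<open>H \<times> G\<close> matrix, this says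
  \<open>K\<^sub>k x = y K\<^sub>k\<close> for all \<open>k\<close>; stating it through \<open>M\<close> avoids the decomposition.\<close>

definition intertwined :: "('g \<Rightarrow> 'g \<Rightarrow> real) \<Rightarrow> ('h \<Rightarrow> 'h \<Rightarrow> real) \<Rightarrow> bool" where
  "intertwined x y \<longleftrightarrow> (\<forall>h g' i.
     (\<Sum>g\<in>UNIV. x g g' * M $ (g, h) $ i) = (\<Sum>h'\<in>UNIV. y h h' * M $ (g', h') $ i))"

text \<open>In terms of the \<open>K\<^sub>k\<close>:
  \<open>K x x' = y K x' = y y' K\<close>.\<close>

lemma intertwined_mult:
  assumes "intertwined x y" "intertwined x' y'"
  shows "intertwined (\<lambda>g g'. \<Sum>p\<in>UNIV. x g p * x' p g') (\<lambda>h h'. \<Sum>q\<in>UNIV. y h q * y' q h')"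
  unfolding intertwined_def
proof (intro allI)
  fix h g' i
  have "(\<Sum>g\<in>UNIV. (\<Sum>p\<in>UNIV. x g p * x' p g') * M $ (g, h) $ i)
      = (\<Sum>p\<in>UNIV. x' p g' * (\<Sum>g\<in>UNIV. x g p * M $ (g, h) $ i))"
    unfolding sum_distrib_left sum_distrib_right by (subst sum.swap) (simp add: mult_ac)
  also have "\<dots> = (\<Sum>p\<in>UNIV. x' p g' * (\<Sum>q\<in>UNIV. y h q * M $ (p, q) $ i))"
    using assms(1) by (simp add: intertwined_def del: split_paired_All)
  also have "\<dots> = (\<Sum>q\<in>UNIV. y h q * (\<Sum>p\<in>UNIV. x' p g' * M $ (p, q) $ i))"
    unfolding sum_distrib_left by (subst sum.swap) (simp add: mult_ac)
  also have "\<dots> = (\<Sum>q\<in>UNIV. y h q * (\<Sum>h'\<in>UNIV. y' q h' * M $ (g', h') $ i))"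
    using assms(2) by (simp add: intertwined_def del: split_paired_All)
  also have "\<dots> = (\<Sum>h'\<in>UNIV. (\<Sum>q\<in>UNIV. y h q * y' q h') * M $ (g', h') $ i)"
    unfolding sum_distrib_left sum_distrib_right by (subst sum.swap) (simp add: mult_ac)
  finally show "(\<Sum>g\<in>UNIV. (\<Sum>p\<in>UNIV. x g p * x' p g') * M $ (g, h) $ i)
      = (\<Sum>h'\<in>UNIV. (\<Sum>q\<in>UNIV. y h q * y' q h') * M $ (g', h') $ i)" .
qed

text \<open>Summed over k, \<open>K x K\<^sup>T = y K K\<^sup>T\<close>, and
  \<open>sum_diag_left\<close> says that the \<open>K K\<^sup>T\<close> add up to the
  identity.\<close>

lemma intertwined_apply:
  assumes "intertwined x y"
  shows "(\<Sum>g\<in>UNIV. \<Sum>g'\<in>UNIV. M $ (g, h) $ (g', h') * x g g') = y h h'"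
proof -
  have "(\<Sum>g\<in>UNIV. \<Sum>g'\<in>UNIV. M $ (g, h) $ (g', h') * x g g')
      = (\<Sum>g'\<in>UNIV. \<Sum>g\<in>UNIV. x g g' * M $ (g, h) $ (g', h'))"
    by (subst sum.swap) (simp add: mult_ac)
  also have "\<dots> = (\<Sum>g'\<in>UNIV. \<Sum>q\<in>UNIV. y h q * M $ (g', q) $ (g', h'))"
    using assms by (simp add: intertwined_def del: split_paired_All)
  also have "\<dots> = (\<Sum>q\<in>UNIV. y h q * (\<Sum>g'\<in>UNIV. M $ (g', q) $ (g', h')))"
    unfolding sum_distrib_left by (subst sum.swap) simp
  also have "\<dots> = y h h'"
    by (simp add: sum_diag_left if_distrib cong: if_cong)
  finally show ?thesis .
qed

text \<open>The diagonal of \<open>y\<close> averages that of \<open>x\<close>, since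
  \<open>diag\<close> removes all other weights.\<close>

lemma intertwined_trace:
  assumes "intertwined x y"
  shows "(\<Sum>g\<in>UNIV. x g g) = (\<Sum>h\<in>UNIV. y h h)"
proof -
  have *: "(\<Sum>g'\<in>UNIV. M $ (g, h) $ (g', h) * x g g') = M $ (g, h) $ (g, h) * x g g" for g h
    using diag[of g h _ h] by (intro sum_UNIV_single) auto
  have "(\<Sum>h\<in>UNIV. y h h) = (\<Sum>h\<in>UNIV. \<Sum>g\<in>UNIV. M $ (g, h) $ (g, h) * x g g)"
    by (simp add: * flip: intertwined_apply[OF assms])
  also have "\<dots> = (\<Sum>g\<in>UNIV. x g g)"
    by (subst sum.swap) (simp add: sum_diag_right flip: sum_distrib_right)
  finally show ?thesis ..
qed

text \<open>The form values below add up to the squared Frobenius norms of all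
  \<open>K\<^sub>k x - y K\<^sub>k\<close>. Expanded, the square terms give the norms of
  \<open>x\<close> and \<open>y\<close>; linkedness turns the mixed terms into the same
  number.\<close>

lemma linked_imp_intertwined:
  assumes xy: "linked x y"
  shows "intertwined x y"
  unfolding intertwined_def
proof (intro allI)
  fix h g' i
  \<comment> \<open>The claim is \<open>M w = 0\<close> for all these \<open>w\<close>; the values \<open>w \<bullet> M w\<close> are nonnegative and
    their sum is \<open>s - s - s + s\<close>.\<close>
  define w :: "'h \<Rightarrow> 'g \<Rightarrow> real^('g \<times> 'h)" where
    "w h g' = (\<chi> i. (if snd i = h then x (fst i) g' else 0) - (if fst i = g' then y h (snd i) else 0))"
    for h g'
  have Mw: "(M *v w h g') $ i
      = (\<Sum>g\<in>UNIV. x g g' * M $ (g, h) $ i) - (\<Sum>h'\<in>UNIV. y h h' * M $ (g', h') $ i)" for h g' i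
  proof -
    have "(M *v w h g') $ i = (\<Sum>g\<in>UNIV. \<Sum>q\<in>UNIV. M $ i $ (g, q) * w h g' $ (g, q))"
      by (simp add: matrix_vector_mult_def sum_UNIV_prod)
    also have "\<dots> = (\<Sum>g\<in>UNIV. \<Sum>q\<in>UNIV. (if q = h then M $ i $ (g, q) * x g g' else 0))
        - (\<Sum>q\<in>UNIV. \<Sum>g\<in>UNIV. (if g = g' then M $ i $ (g, q) * y h q else 0))"
      by (subst sum.swap[of "\<lambda>q g. if g = g' then _ g q else _ g q"])
        (simp only: w_def vec_lambda_beta fst_conv snd_conv right_diff_distrib sum_subtractf
          if_distrib[where f = "times _"] mult_zero_right)
    also have "\<dots> = (\<Sum>g\<in>UNIV. x g g' * M $ (g, h) $ i) - (\<Sum>h'\<in>UNIV. y h h' * M $ (g', h') $ i)"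
      by (simp add: mult.commute sym[of i])
    finally show ?thesis .
  qed
  have form: "w h g' \<bullet> (M *v w h g')
     = (\<Sum>p\<in>UNIV. x p g' * (M *v w h g') $ (p, h)) - (\<Sum>q\<in>UNIV. y h q * (M *v w h g') $ (g', q))"
    for h g'
  proof -
    have "w h g' \<bullet> (M *v w h g') = (\<Sum>g\<in>UNIV. \<Sum>q\<in>UNIV. w h g' $ (g, q) * (M *v w h g') $ (g, q))"
      by (simp add: inner_vec_def sum_UNIV_prod)
    also have "\<dots> = (\<Sum>g\<in>UNIV. \<Sum>q\<in>UNIV. (if q = h then x g g' * (M *v w h g') $ (g, q) else 0))
        - (\<Sum>q\<in>UNIV. \<Sum>g\<in>UNIV. (if g = g' then y h q * (M *v w h g') $ (g, q) else 0))"
      by (subst sum.swap[of "\<lambda>q g. if g = g' then _ g q else _ g q"])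
        (simp only: w_def[of h g'] vec_lambda_beta fst_conv snd_conv left_diff_distrib sum_subtractf
          if_distrib[where f = "\<lambda>z. z * _"] mult_zero_left)
    also have "\<dots> = (\<Sum>p\<in>UNIV. x p g' * (M *v w h g') $ (p, h))
        - (\<Sum>q\<in>UNIV. y h q * (M *v w h g') $ (g', q))"
      by simp
    finally show ?thesis .
  qed
  \<comment> \<open>Within one \<open>h\<close>, or one \<open>g'\<close>, \<open>diag\<close>
    leaves only diagonal entries of \<open>M\<close>.\<close>
  have xx: "(\<Sum>g\<in>UNIV. x g g' * M $ (g, h) $ (p, h)) = x p g' * M $ (p, h) $ (p, h)" for p h g'
    using diag[of _ h p h] by (intro sum_UNIV_single) auto
  have yy: "(\<Sum>r\<in>UNIV. y h r * M $ (g', r) $ (g', q)) = y h q * M $ (g', q) $ (g', q)" for q h g'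
    using diag[of g' _ g' q] by (intro sum_UNIV_single) auto
  define s where "s = (\<Sum>g\<in>UNIV. \<Sum>g'\<in>UNIV. (x g g')\<^sup>2)"
  have "linked (\<lambda>g g'. (x g g')\<^sup>2) (\<lambda>h h'. (y h h')\<^sup>2)"
    using xy by (simp add: linked_def)
  from linked_sum[OF this] have s': "s = (\<Sum>h\<in>UNIV. \<Sum>h'\<in>UNIV. (y h h')\<^sup>2)"
    by (simp add: s_def)
  have t1: "(\<Sum>h\<in>UNIV. \<Sum>g'\<in>UNIV. \<Sum>p\<in>UNIV. x p g' * (x p g' * M $ (p, h) $ (p, h))) = s"
  proof -
    have "(\<Sum>h\<in>UNIV. \<Sum>g'\<in>UNIV. \<Sum>p\<in>UNIV. x p g' * (x p g' * M $ (p, h) $ (p, h)))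
       = (\<Sum>g'\<in>UNIV. \<Sum>p\<in>UNIV. \<Sum>h\<in>UNIV. (x p g')\<^sup>2 * M $ (p, h) $ (p, h))"
      by (subst sum.swap, subst (2) sum.swap) (simp add: power2_eq_square mult_ac)
    also have "\<dots> = s"
      unfolding s_def by (subst (2) sum.swap) (simp add: sum_diag_right flip: sum_distrib_left)
    finally show ?thesis .
  qed
  have t4: "(\<Sum>h\<in>UNIV. \<Sum>g'\<in>UNIV. \<Sum>q\<in>UNIV. y h q * (y h q * M $ (g', q) $ (g', q))) = s"
  proof -
    have "(\<Sum>h\<in>UNIV. \<Sum>g'\<in>UNIV. \<Sum>q\<in>UNIV. y h q * (y h q * M $ (g', q) $ (g', q)))
       = (\<Sum>h\<in>UNIV. \<Sum>q\<in>UNIV. \<Sum>g'\<in>UNIV. (y h q)\<^sup>2 * M $ (g', q) $ (g', q))"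
      by (subst (2) sum.swap) (simp add: power2_eq_square mult_ac)
    also have "\<dots> = s"
      unfolding s' by (simp add: sum_diag_left flip: sum_distrib_left)
    finally show ?thesis .
  qed
  \<comment> \<open>On the support, \<open>y h q = x p g'\<close>.\<close>
  have cross: "x p g' * (y h q * M $ (g', q) $ (p, h)) = M $ (p, h) $ (g', q) * (x p g')\<^sup>2" for p g' h q
    using linked_mult[OF xy, of p h g' q] sym[of "(g', q)" "(p, h)"]
    by (auto simp: power2_eq_square)
  have t2: "(\<Sum>h\<in>UNIV. \<Sum>g'\<in>UNIV. \<Sum>p\<in>UNIV. \<Sum>q\<in>UNIV. x p g' * (y h q * M $ (g', q) $ (p, h))) = s"
  proof -
    have "(\<Sum>h\<in>UNIV. \<Sum>g'\<in>UNIV. \<Sum>p\<in>UNIV. \<Sum>q\<in>UNIV. M $ (p, h) $ (g', q) * (x p g')\<^sup>2)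
        = (\<Sum>p\<in>UNIV. \<Sum>g'\<in>UNIV. \<Sum>h\<in>UNIV. \<Sum>q\<in>UNIV. M $ (p, h) $ (g', q) * (x p g')\<^sup>2)"
      by (subst sum.swap, subst (2) sum.swap, subst sum.swap) simp
    then show ?thesis
      unfolding cross s_def sum_weighted_left .
  qed
  have t3: "(\<Sum>h\<in>UNIV. \<Sum>g'\<in>UNIV. \<Sum>q\<in>UNIV. \<Sum>p\<in>UNIV. y h q * (x p g' * M $ (p, h) $ (g', q))) = s"
  proof -
    have "(\<Sum>q\<in>UNIV. \<Sum>p\<in>UNIV. y h q * (x p g' * M $ (p, h) $ (g', q)))
        = (\<Sum>p\<in>UNIV. \<Sum>q\<in>UNIV. x p g' * (y h q * M $ (g', q) $ (p, h)))" for h g'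
      by (subst sum.swap) (simp add: mult_ac sym[of "(_, h)" "(g', _)"])
    then show ?thesis
      using t2 by simp
  qed
  have form': "w h g' \<bullet> (M *v w h g')
     = (\<Sum>p\<in>UNIV. x p g' * (x p g' * M $ (p, h) $ (p, h)))
     - (\<Sum>p\<in>UNIV. \<Sum>q\<in>UNIV. x p g' * (y h q * M $ (g', q) $ (p, h)))
     - ((\<Sum>q\<in>UNIV. \<Sum>p\<in>UNIV. y h q * (x p g' * M $ (p, h) $ (g', q)))
     - (\<Sum>q\<in>UNIV. y h q * (y h q * M $ (g', q) $ (g', q))))" for h g'
    unfolding form Mw xx yy by (simp add: right_diff_distrib sum_subtractf sum_distrib_left)
  have "(\<Sum>h\<in>UNIV. \<Sum>g'\<in>UNIV. w h g' \<bullet> (M *v w h g')) = 0"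
    unfolding form' sum_subtractf t1 t2 t3 t4 by simp
  moreover have nn: "0 \<le> w h g' \<bullet> (M *v w h g')" for h g'
    using psd by (simp add: pos_semidef_def)
  ultimately have "(\<Sum>g'\<in>UNIV. w h g' \<bullet> (M *v w h g')) = 0" for h
    by (intro sum_zero_imp_zero[of "\<lambda>h. \<Sum>g'\<in>UNIV. w h g' \<bullet> (M *v w h g')"] sum_nonneg)
  then have "w h g' \<bullet> (M *v w h g') = 0"
    using nn by (intro sum_zero_imp_zero[of "\<lambda>g'. w h g' \<bullet> (M *v w h g')"])
  then have "M *v w h g' = 0"
    by (rule pos_semidef_kernel[OF psd])
  then show "(\<Sum>g\<in>UNIV. x g g' * M $ (g, h) $ i) = (\<Sum>h'\<in>UNIV. y h h' * M $ (g', h') $ i)"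
    using Mw[of h g' i] by simp
qed

text \<open>The \<open>M\<close>-weighted sum of \<open>(x g g' - y h h')\<^sup>2\<close> is
  \<open>|x|^2 + |y|^2 - 2 |y|^2\<close> with \<open>|x| = |y|\<close>, hence 0, and so is each of
  its terms.\<close>

lemma intertwined_imp_linked:
  assumes xy: "intertwined x y" and xyT: "intertwined (\<lambda>g g'. x g' g) (\<lambda>h h'. y h' h)"
  shows "linked x y"
proof -
  let ?m = "\<lambda>g g' h h'. M $ (g, h) $ (g', h')"
  \<comment> \<open>These are the traces of \<open>x x\<^sup>T\<close> and
    \<open>y y\<^sup>T\<close>, whence the hypothesis on transposes.\<close>
  have norm: "(\<Sum>g\<in>UNIV. \<Sum>g'\<in>UNIV. (x g g')\<^sup>2) = (\<Sum>h\<in>UNIV. \<Sum>h'\<in>UNIV. (y h h')\<^sup>2)"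
    using intertwined_trace[OF intertwined_mult[OF xy xyT]] by (simp add: power2_eq_square)
  have cross: "(\<Sum>g\<in>UNIV. \<Sum>g'\<in>UNIV. \<Sum>h\<in>UNIV. \<Sum>h'\<in>UNIV. y h h' * (?m g g' h h' * x g g'))
      = (\<Sum>h\<in>UNIV. \<Sum>h'\<in>UNIV. (y h h')\<^sup>2)"
    by (subst sum_reorder)
      (simp add: power2_eq_square intertwined_apply[OF xy] flip: sum_distrib_left)
  have eq: "?m g g' h h' * (x g g' - y h h')\<^sup>2 = ?m g g' h h' * (x g g')\<^sup>2 + ?m g g' h h' * (y h h')\<^sup>2
      - 2 * (y h h' * (?m g g' h h' * x g g'))" for g g' h h'
    by (simp add: power2_eq_square algebra_simps)
  have "(\<Sum>g\<in>UNIV. \<Sum>g'\<in>UNIV. \<Sum>h\<in>UNIV. \<Sum>h'\<in>UNIV. ?m g g' h h' * (x g g' - y h h')\<^sup>2) = 0"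
    unfolding eq sum_subtractf sum.distrib sum_distrib_left[symmetric] cross
    by (simp add: sum_weighted_left sum_weighted_right norm sum_distrib_left)
  then have "?m g g' h h' * (x g g' - y h h')\<^sup>2 = 0" for g g' h h'
    using nonneg
    by (auto simp: sum_nonneg_eq_0_iff sum_nonneg)
  then show ?thesis
    by (auto simp: linked_def)
qed

text \<open>Intertwining is stable under products, and together with its transposed form it is
  equivalent to being linked.\<close>

lemma linked_matrix_mult_real:
  fixes x :: "'g \<Rightarrow> 'g \<Rightarrow> real"
  assumes "linked x y" "linked x' y'"
  shows "linked (\<lambda>g g'. \<Sum>p\<in>UNIV. x g p * x' p g') (\<lambda>h h'. \<Sum>q\<in>UNIV. y h q * y' q h')"
proof (rule intertwined_imp_linked)
  show "intertwined (\<lambda>g g'. \<Sum>p\<in>UNIV. x g p * x' p g') (\<lambda>h h'. \<Sum>q\<in>UNIV. y h q * y' q h')"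
    by (rule intertwined_mult[OF assms[THEN linked_imp_intertwined]])
  have "intertwined (\<lambda>g g'. \<Sum>p\<in>UNIV. x' p g * x g' p) (\<lambda>h h'. \<Sum>q\<in>UNIV. y' q h * y h' q)"
    by (rule intertwined_mult[OF assms(2)[THEN linked_transpose, THEN linked_imp_intertwined] assms(1)[THEN linked_transpose, THEN linked_imp_intertwined]])
  then show "intertwined (\<lambda>g g'. \<Sum>p\<in>UNIV. x g' p * x' p g) (\<lambda>h h'. \<Sum>q\<in>UNIV. y h' q * y' q h)"
    by (simp add: mult.commute)
qed

lemma linked_matrix_mult:
  fixes x :: "'g \<Rightarrow> 'g \<Rightarrow> complex"
  assumes "linked x y" "linked x' y'"
  shows "linked (\<lambda>g g'. \<Sum>p\<in>UNIV. x g p * x' p g') (\<lambda>h h'. \<Sum>q\<in>UNIV. y h q * y' q h')"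
proof -
  \<comment> \<open>Links survive any entrywise function, so a complex product reduces to four real
    ones.\<close>
  have part: "linked (\<lambda>g g'. f (x g g')) (\<lambda>h h'. f (y h h'))"
    "linked (\<lambda>g g'. f (x' g g')) (\<lambda>h h'. f (y' h h'))" for f :: "complex \<Rightarrow> real"
    using assms by (auto simp: linked_def)
  note * = linked_matrix_mult_real[OF part(1) part(2)]
  show ?thesis
    using *[of Re Re] *[of Re Im] *[of Im Re] *[of Im Im]
    by (simp add: linked_def complex_eq_iff sum_subtractf sum.distrib)
qed

end

section \<open>Closure properties of coherent algebras\<close>

lemma coherent_algebra_iff:
  "coherent_algebra A \<longleftrightarrow>
     0 \<in> A \<and>
     (\<forall>M\<in>A. \<forall>N\<in>A. M + N \<in> A) \<and>
     (\<forall>c. \<forall>M\<in>A. smult_matrix c M \<in> A) \<and>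
     (\<forall>M\<in>A. \<forall>N\<in>A. M ** N \<in> A) \<and>
     mat 1 \<in> A \<and>
     all_ones \<in> A \<and>
     (\<forall>M\<in>A. \<forall>N\<in>A. schur_product M N \<in> A) \<and>
     (\<forall>M\<in>A. conj_transpose M \<in> A)"
proof -
  interpret vector_space smult_matrix
    by (rule vector_space_smult_matrix)
  show ?thesis
    unfolding coherent_algebra_def subspace_def by blast
qed

lemma coherent_graph_coherent_algebra: "coherent_algebra (graph_coherent_algebra G)"
  unfolding graph_coherent_algebra_def coherent_algebra_iff by simp

lemma adj_matrix_in_graph_coherent_algebra: "adj_matrix G \<in> graph_coherent_algebra G"
  by (simp add: graph_coherent_algebra_def)

lemma graph_coherent_algebra_least:
  "coherent_algebra A \<Longrightarrow> adj_matrix G \<in> A \<Longrightarrow> graph_coherent_algebra G \<subseteq> A"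
  by (auto simp: graph_coherent_algebra_def)

text \<open>Each operation is carried out on the partners in \<open>B\<close> as well. The relation
  is abstract so that \<open>linked_matrices\<close> can be used in both directions.\<close>

lemma coherent_algebra_related:
  fixes L :: "complex^'m^'m \<Rightarrow> complex^'n^'n \<Rightarrow> bool"
  assumes B: "coherent_algebra B"
    and "L 0 0" "L (mat 1) (mat 1)" "L all_ones all_ones"
    and "\<And>X Y X' Y'. L X Y \<Longrightarrow> L X' Y' \<Longrightarrow> L (X + X') (Y + Y')"
    and "\<And>c X Y. L X Y \<Longrightarrow> L (smult_matrix c X) (smult_matrix c Y)"
    and "\<And>X Y X' Y'. L X Y \<Longrightarrow> L X' Y' \<Longrightarrow> L (X ** X') (Y ** Y')"
    and "\<And>X Y X' Y'. L X Y \<Longrightarrow> L X' Y' \<Longrightarrow> L (schur_product X X') (schur_product Y Y')"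
    and "\<And>X Y. L X Y \<Longrightarrow> L (conj_transpose X) (conj_transpose Y)"
  shows "coherent_algebra {X. \<exists>Y\<in>B. L X Y}" (is "coherent_algebra ?S")
proof -
  note B = B[unfolded coherent_algebra_iff]
  have "0 \<in> ?S" "mat 1 \<in> ?S" "all_ones \<in> ?S"
    using B assms(2-4) by auto
  moreover have "M + N \<in> ?S" "M ** N \<in> ?S" "schur_product M N \<in> ?S" if "M \<in> ?S" "N \<in> ?S" for M N
  proof -
    from that obtain X Y where "L M X" "L N Y" "X \<in> B" "Y \<in> B"
      by auto
    then show "M + N \<in> ?S" "M ** N \<in> ?S" "schur_product M N \<in> ?S"
      using B assms(5)[of M X N Y] assms(7)[of M X N Y] assms(8)[of M X N Y] by auto
  qed
  moreover have "smult_matrix c M \<in> ?S" "conj_transpose M \<in> ?S" if "M \<in> ?S" for c M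
  proof -
    from that obtain X where "L M X" "X \<in> B"
      by auto
    then show "smult_matrix c M \<in> ?S" "conj_transpose M \<in> ?S"
      using B assms(6)[of M X c] assms(9)[of M X] by auto
  qed
  ultimately show ?thesis
    unfolding coherent_algebra_iff by simp
qed

section \<open>The isomorphism formed by linked matrices\<close>

context dnn_isomorphism
begin

definition linked_matrices :: "complex^'g^'g \<Rightarrow> complex^'h^'h \<Rightarrow> bool" where
  "linked_matrices X Y \<longleftrightarrow> linked (\<lambda>g g'. X $ g $ g') (\<lambda>h h'. Y $ h $ h')"

lemma linked_matrices_0: "linked_matrices 0 0"
  and linked_matrices_one: "linked_matrices (mat 1) (mat 1)"
  and linked_matrices_all_ones: "linked_matrices all_ones all_ones"
  and linked_matrices_add: "linked_matrices X Y \<Longrightarrow> linked_matrices X' Y' \<Longrightarrow> linked_matrices (X + X') (Y + Y')"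
  and linked_matrices_smult: "linked_matrices X Y \<Longrightarrow> linked_matrices (smult_matrix c X) (smult_matrix c Y)"
  and linked_matrices_schur: "linked_matrices X Y \<Longrightarrow> linked_matrices X' Y' \<Longrightarrow>
    linked_matrices (schur_product X X') (schur_product Y Y')"
  using diag
  by (auto simp: linked_matrices_def linked_def mat_def all_ones_def smult_matrix_def schur_product_def)

lemma linked_matrices_conj_transpose:
  "linked_matrices X Y \<Longrightarrow> linked_matrices (conj_transpose X) (conj_transpose Y)"
  unfolding linked_matrices_def by (drule linked_transpose) (simp add: linked_def conj_transpose_def)

lemma linked_matrices_mult:
  "linked_matrices X Y \<Longrightarrow> linked_matrices X' Y' \<Longrightarrow> linked_matrices (X ** X') (Y ** Y')"
  unfolding linked_matrices_def matrix_matrix_mult_def vec_lambda_beta by (rule linked_matrix_mult)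

lemma coherent_algebra_linked_left:
  "coherent_algebra B \<Longrightarrow> coherent_algebra {X. \<exists>Y\<in>B. linked_matrices X Y}"
  by (rule coherent_algebra_related)
    (simp_all add: linked_matrices_0 linked_matrices_one linked_matrices_all_ones linked_matrices_add
      linked_matrices_smult linked_matrices_schur linked_matrices_mult linked_matrices_conj_transpose)

lemma coherent_algebra_linked_right:
  "coherent_algebra A \<Longrightarrow> coherent_algebra {Y. \<exists>X\<in>A. linked_matrices X Y}"
  by (rule coherent_algebra_related)
    (simp_all add: linked_matrices_0 linked_matrices_one linked_matrices_all_ones linked_matrices_add
      linked_matrices_smult linked_matrices_schur linked_matrices_mult linked_matrices_conj_transpose)

lemma linked_matrices_unique_right: "linked_matrices X Y \<Longrightarrow> linked_matrices X Y' \<Longrightarrow> Y = Y'"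
  using linked_unique_right[of "\<lambda>g g'. X $ g $ g'" "\<lambda>h h'. Y $ h $ h'" "\<lambda>h h'. Y' $ h $ h'"]
  by (simp add: linked_matrices_def vec_eq_iff)

lemma linked_matrices_unique_left: "linked_matrices X Y \<Longrightarrow> linked_matrices X' Y \<Longrightarrow> X = X'"
  using linked_unique_left[of "\<lambda>g g'. X $ g $ g'" "\<lambda>h h'. Y $ h $ h'" "\<lambda>g g'. X' $ g $ g'"]
  by (simp add: linked_matrices_def vec_eq_iff)

text \<open>Matrices with a partner in the other algebra form a coherent algebra containing the
  adjacency matrix, so by minimality every matrix of either algebra has such a partner.\<close>

lemma coherent_algebra_iso_of_linked:
  assumes adj: "linked_matrices (adj_matrix G) (adj_matrix H)"
  shows "\<exists>\<phi>. coherent_algebra_iso (graph_coherent_algebra G) (graph_coherent_algebra H) \<phi> \<and>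
         \<phi> (adj_matrix G) = adj_matrix H"
proof -
  let ?A = "graph_coherent_algebra G" and ?B = "graph_coherent_algebra H"
  define \<phi> where "\<phi> X = (THE Y. linked_matrices X Y)" for X
  have \<phi>: "\<phi> X = Y" if "linked_matrices X Y" for X Y
    unfolding \<phi>_def using that linked_matrices_unique_right by blast
  have "?A \<subseteq> {X. \<exists>Y\<in>?B. linked_matrices X Y}"
    using adj adj_matrix_in_graph_coherent_algebra[of H]
    by (intro graph_coherent_algebra_least coherent_algebra_linked_left
        coherent_graph_coherent_algebra) blast
  then have left: "\<phi> X \<in> ?B" "linked_matrices X (\<phi> X)" if "X \<in> ?A" for X
    using that \<phi> by blast+
  have "?B \<subseteq> {Y. \<exists>X\<in>?A. linked_matrices X Y}"
    using adj adj_matrix_in_graph_coherent_algebra[of G]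
    by (intro graph_coherent_algebra_least coherent_algebra_linked_right
        coherent_graph_coherent_algebra) blast
  then have right: "\<exists>X\<in>?A. \<phi> X = Y" if "Y \<in> ?B" for Y
    using that \<phi> by blast
  have "bij_betw \<phi> ?A ?B"
    unfolding bij_betw_def
  proof
    show "inj_on \<phi> ?A"
      by (rule inj_onI) (metis left(2) linked_matrices_unique_left)
    show "\<phi> ` ?A = ?B"
      using left(1) right by blast
  qed
  then have "coherent_algebra_iso ?A ?B \<phi>"
    unfolding coherent_algebra_iso_def
    by (auto intro!: \<phi> linked_matrices_add linked_matrices_smult linked_matrices_conj_transpose
        linked_matrices_mult linked_matrices_schur left(2))
  with \<phi>[OF adj] show ?thesis
    by blast
qed

end

section \<open>The DNN matrix given by an isomorphism\<close>

text \<open>The operator \<open>D\<close> commutes with \<open>M\<close>; writing \<open>v = D u\<close> turns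
  \<open>v \<bullet> M v\<close> into \<open>M u \<bullet> D (M u)\<close>.\<close>

lemma pos_semidef_if_square_eq_mult:
  fixes M D :: "real^'n^'n"
  assumes M: "transpose M = M" and D: "transpose D = D"
    and sq: "M ** M = D ** M" and pos: "\<And>v. v \<noteq> 0 \<Longrightarrow> 0 < v \<bullet> (D *v v)"
  shows "pos_semidef M"
  unfolding pos_semidef_def
proof (intro conjI allI M)
  fix v
  \<comment> \<open>\<open>D ** M\<close> equals the symmetric matrix \<open>M ** M\<close>, so it
    equals its own transpose.\<close>
  have "M ** D = transpose (D ** M)"
    by (simp only: matrix_transpose_mul M D)
  also have "\<dots> = M ** M"
    by (simp only: matrix_transpose_mul M flip: sq)
  finally have comm: "M ** D = D ** M"
    by (simp only: sq)
  have "inj ((*v) D)"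
    unfolding linear_injective_0[OF matrix_vector_mul_linear]
  proof (intro allI impI)
    show "x = 0" if "D *v x = 0" for x
      using pos[of x] that by (cases "x = 0") auto
  qed
  then have "surj ((*v) D)"
    by (rule linear_inj_imp_surj[OF matrix_vector_mul_linear])
  then obtain u where v: "v = D *v u"
    by (metis surjD)
  have adjoint: "x \<bullet> (N *v y) = (N *v x) \<bullet> y" if "transpose N = N" for N :: "real^'n^'n" and x y
    using that by (metis dot_lmul_matrix vector_transpose_matrix)
  have "v \<bullet> (M *v v) = u \<bullet> ((D ** (M ** D)) *v u)"
    by (simp add: v adjoint[OF D, symmetric] matrix_vector_mul_assoc)
  also have "D ** (M ** D) = D ** (M ** M)"
    by (simp only: comm sq)
  also have "\<dots> = (M ** D) ** M"
    by (simp only: comm matrix_mul_assoc)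
  also have "\<dots> = M ** (D ** M)"
    by (rule matrix_mul_assoc[symmetric])
  also have "u \<bullet> ((M ** (D ** M)) *v u) = (M *v u) \<bullet> (D *v (M *v u))"
    by (simp add: adjoint[OF M, symmetric] matrix_vector_mul_assoc)
  also have "\<dots> \<ge> 0"
    using pos[of "M *v u"] by (cases "M *v u = 0") auto
  finally show "0 \<le> v \<bullet> (M *v v)" .
qed

text \<open>The cells are the minimal idempotents for the Schur product.\<close>

definition cell :: "(complex^'n^'n) set \<Rightarrow> 'n \<Rightarrow> 'n \<Rightarrow> complex^'n^'n" where
  "cell A a b = (\<chi> i j. of_bool (\<forall>X\<in>A. X $ i $ j = X $ a $ b))"

lemma smult_matrix_zero: "smult_matrix 0 X = 0"
  by (simp add: smult_matrix_def vec_eq_iff)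

section \<open>Isomorphisms of coherent algebras and the matching of entries\<close>

locale coherent_algebra_isomorphism =
  fixes A :: "(complex^'m::finite^'m) set" and B :: "(complex^'n::finite^'n) set"
    and \<phi> :: "complex^'m^'m \<Rightarrow> complex^'n^'n"
  assumes A: "coherent_algebra A" and B: "coherent_algebra B" and iso: "coherent_algebra_iso A B \<phi>"
begin

lemma closed:
  shows zero_in: "0 \<in> A" and add_in: "X \<in> A \<Longrightarrow> Y \<in> A \<Longrightarrow> X + Y \<in> A"
    and smult_in: "X \<in> A \<Longrightarrow> smult_matrix c X \<in> A" and mult_in: "X \<in> A \<Longrightarrow> Y \<in> A \<Longrightarrow> X ** Y \<in> A"
    and one_in: "mat 1 \<in> A" and all_ones_in: "all_ones \<in> A"
    and schur_in: "X \<in> A \<Longrightarrow> Y \<in> A \<Longrightarrow> schur_product X Y \<in> A"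
    and conj_transpose_in: "X \<in> A \<Longrightarrow> conj_transpose X \<in> A"
  using A by (auto simp: coherent_algebra_iff)

lemma iso_simps:
  shows phi_add: "X \<in> A \<Longrightarrow> Y \<in> A \<Longrightarrow> \<phi> (X + Y) = \<phi> X + \<phi> Y"
    and phi_smult: "X \<in> A \<Longrightarrow> \<phi> (smult_matrix c X) = smult_matrix c (\<phi> X)"
    and phi_mult: "X \<in> A \<Longrightarrow> Y \<in> A \<Longrightarrow> \<phi> (X ** Y) = \<phi> X ** \<phi> Y"
    and phi_schur: "X \<in> A \<Longrightarrow> Y \<in> A \<Longrightarrow> \<phi> (schur_product X Y) = schur_product (\<phi> X) (\<phi> Y)"
    and phi_conj_transpose: "X \<in> A \<Longrightarrow> \<phi> (conj_transpose X) = conj_transpose (\<phi> X)"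
    and phi_inj: "inj_on \<phi> A" and phi_image: "\<phi> ` A = B"
  using iso by (auto simp: coherent_algebra_iso_def bij_betw_def)

lemma phi_zero: "\<phi> 0 = 0"
  using phi_smult[OF zero_in, of 0] by (simp add: smult_matrix_zero)

text \<open>A surjective multiplicative map preserves the unit: multiply a preimage of the unit by
  \<open>mat 1\<close>. The Schur unit is treated in the same way below.\<close>

lemma phi_one: "\<phi> (mat 1) = mat 1"
proof -
  obtain X where X: "X \<in> A" "\<phi> X = mat 1"
    using B phi_image by (auto simp: coherent_algebra_iff)
  have "\<phi> (X ** mat 1) = \<phi> (mat 1)"
    unfolding phi_mult[OF X(1) one_in] X(2) by simp
  then show ?thesis
    using X(2) by simp
qed

lemma phi_all_ones: "\<phi> all_ones = all_ones"
proof -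
  obtain X where X: "X \<in> A" "\<phi> X = all_ones"
    using B phi_image by (auto simp: coherent_algebra_iff)
  have "\<phi> (schur_product X all_ones) = \<phi> all_ones"
    unfolding phi_schur[OF X(1) all_ones_in] X(2) by (simp add: schur_product_def all_ones_def vec_eq_iff)
  moreover have "schur_product X all_ones = X"
    by (simp add: schur_product_def all_ones_def vec_eq_iff)
  ultimately show ?thesis
    using X(2) by simp
qed

text \<open>The total is the factor in \<open>all_ones ** X ** all_ones\<close>, a multiple of
  \<open>all_ones\<close>. For cells it gives equal sizes.\<close>

lemma phi_sum_entries:
  assumes "X \<in> A"
  shows "(\<Sum>i\<in>UNIV. \<Sum>j\<in>UNIV. \<phi> X $ i $ j) = (\<Sum>i\<in>UNIV. \<Sum>j\<in>UNIV. X $ i $ j)"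
proof -
  have *: "all_ones ** Y ** all_ones = smult_matrix (\<Sum>i\<in>UNIV. \<Sum>j\<in>UNIV. Y $ i $ j) all_ones"
    for Y :: "complex^'k::finite^'k"
    unfolding all_ones_def smult_matrix_def matrix_matrix_mult_def
    by (simp add: vec_eq_iff) (rule sum.swap)
  have "\<phi> (all_ones ** X ** all_ones) = all_ones ** \<phi> X ** all_ones"
    by (simp add: phi_mult mult_in assms all_ones_in phi_all_ones)
  then show ?thesis
    unfolding * phi_smult[OF all_ones_in] phi_all_ones
    by (simp add: smult_matrix_def all_ones_def vec_eq_iff)
qed

lemma schur_prod:
  assumes "finite S" "\<And>s. s \<in> S \<Longrightarrow> Z s \<in> A"
  shows "(\<chi> i j. \<Prod>s\<in>S. Z s $ i $ j) \<in> A \<and>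
    \<phi> (\<chi> i j. \<Prod>s\<in>S. Z s $ i $ j) = (\<chi> i j. \<Prod>s\<in>S. \<phi> (Z s) $ i $ j)"
  using assms
proof (induction S)
  case empty
  then show ?case
    using all_ones_in phi_all_ones by (simp add: all_ones_def)
next
  case (insert s S)
  let ?P = "\<chi> i j. \<Prod>s\<in>S. Z s $ i $ j"
  have *: "?P \<in> A" "\<phi> ?P = (\<chi> i j. \<Prod>s\<in>S. \<phi> (Z s) $ i $ j)" "Z s \<in> A"
    using insert by auto
  have "(\<chi> i j. \<Prod>s\<in>insert s S. Z s $ i $ j) = schur_product (Z s) ?P"
    using insert.hyps by (simp add: schur_product_def vec_eq_iff)
  moreover have "(\<chi> i j. \<Prod>s\<in>insert s S. \<phi> (Z s) $ i $ j) = schur_product (\<phi> (Z s)) (\<phi> ?P)"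
    using insert.hyps by (simp add: schur_product_def vec_eq_iff *(2))
  ultimately show ?case
    using * by (simp add: schur_in phi_schur)
qed

text \<open>For \<open>v \<noteq> w\<close>, the affine map sending \<open>v\<close> to 1 and
  \<open>w\<close> to 0: a factor of a Lagrange interpolation.\<close>

definition rescale :: "complex \<Rightarrow> complex \<Rightarrow> complex^'k^'k \<Rightarrow> complex^'k::finite^'k" where
  "rescale v w X = smult_matrix (1 / (v - w)) (X + smult_matrix (- w) all_ones)"

lemma rescale_nth: "rescale v w X $ i $ j = (X $ i $ j - w) / (v - w)"
  by (simp add: rescale_def smult_matrix_def all_ones_def)

lemma rescale_in: "X \<in> A \<Longrightarrow> rescale v w X \<in> A"
  by (simp add: rescale_def add_in smult_in all_ones_in)

lemma phi_rescale: "X \<in> A \<Longrightarrow> \<phi> (rescale v w X) = rescale v w (\<phi> X)"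
  by (simp add: rescale_def phi_add phi_smult add_in smult_in all_ones_in phi_all_ones)

text \<open>Lagrange interpolation: each position \<open>p\<close> outside the cell gives a factor
  that is 0 at \<open>p\<close> and 1 on the cell.\<close>

lemma cell_in: "cell A a b \<in> A"
proof -
  define S where "S = {p. \<exists>X\<in>A. X $ fst p $ snd p \<noteq> X $ a $ b}"
  have "\<forall>p\<in>S. \<exists>X. X \<in> A \<and> X $ fst p $ snd p \<noteq> X $ a $ b"
    by (auto simp: S_def)
  then obtain X where X: "\<And>p. p \<in> S \<Longrightarrow> X p \<in> A \<and> X p $ fst p $ snd p \<noteq> X p $ a $ b"
    by (auto dest!: bchoice)
  define Z where "Z p = rescale (X p $ a $ b) (X p $ fst p $ snd p) (X p)" for p
  have Z: "Z p \<in> A" "Z p $ a $ b = 1" "Z p $ fst p $ snd p = 0" if "p \<in> S" for p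
    using X[OF that] by (auto simp: Z_def rescale_in rescale_nth)
  have "cell A a b $ i $ j = (\<Prod>p\<in>S. Z p $ i $ j)" for i j
  proof (cases "(i, j) \<in> S")
    case True
    have "(\<Prod>p\<in>S. Z p $ i $ j) = 0"
      using True Z(3)[OF True] by (auto simp: prod_zero_iff)
    then show ?thesis
      using True by (auto simp: cell_def S_def)
  next
    case False
    have "(\<Prod>p\<in>S. Z p $ i $ j) = 1"
      using False Z by (intro prod.neutral) (auto simp: S_def)
    then show ?thesis
      using False by (auto simp: cell_def S_def)
  qed
  then have "cell A a b = (\<chi> i j. \<Prod>p\<in>S. Z p $ i $ j)"
    by (simp add: vec_eq_iff)
  then show ?thesis
    using schur_prod[of S Z] Z(1) by simp
qed

text \<open>Evaluation at \<open>(h, h')\<close> after \<open>\<phi>\<close> is a character of the Schur algebra \<open>A\<close>; a match is an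
  entry \<open>(g, g')\<close> representing it.\<close>

definition matched :: "'m \<Rightarrow> 'm \<Rightarrow> 'n \<Rightarrow> 'n \<Rightarrow> bool" where
  "matched g g' h h' \<longleftrightarrow> (\<forall>X\<in>A. X $ g $ g' = \<phi> X $ h $ h')"

text \<open>If some \<open>X p\<close> told each position \<open>p\<close> apart from the character,
  the interpolation factors would have Schur product 0, whose image is nevertheless 1 at
  \<open>(h, h')\<close>.\<close>

lemma matched_left_total: "\<exists>g g'. matched g g' h h'"
proof (rule ccontr)
  assume "\<nexists>g g'. matched g g' h h'"
  then have "\<forall>p. \<exists>X\<in>A. X $ fst p $ snd p \<noteq> \<phi> X $ h $ h'"
    unfolding matched_def by blast
  then obtain X where X: "\<And>p. X p \<in> A" "\<And>p. X p $ fst p $ snd p \<noteq> \<phi> (X p) $ h $ h'"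
    by metis
  define Z where "Z p = rescale (\<phi> (X p) $ h $ h') (X p $ fst p $ snd p) (X p)" for p
  have Z: "Z p \<in> A" "\<phi> (Z p) $ h $ h' = 1" "Z p $ fst p $ snd p = 0" for p
    using X[of p] by (auto simp: Z_def rescale_in phi_rescale rescale_nth)
  have "(\<Prod>p\<in>UNIV. Z p $ i $ j) = 0" for i j
    using Z(3)[of "(i, j)"] by (subst prod_zero_iff) auto
  then have "\<phi> (\<chi> i j. \<Prod>p\<in>UNIV. Z p $ i $ j) = 0"
    by (simp only: phi_zero flip: zero_vec_def)
  moreover have "\<phi> (\<chi> i j. \<Prod>p\<in>UNIV. Z p $ i $ j) = (\<chi> i j. \<Prod>p\<in>UNIV. \<phi> (Z p) $ i $ j)"
    using schur_prod[of UNIV Z] Z(1) by simp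
  ultimately have "(\<Prod>p\<in>(UNIV :: ('m \<times> 'm) set). \<phi> (Z p) $ h $ h') = 0"
    by (simp add: vec_eq_iff)
  then show False
    by (simp add: Z(2))
qed

text \<open>Evaluation at \<open>(h, h')\<close> after \<open>\<phi>\<close> is evaluation at a
  matching position, so the image \<open>B_i\<close> of a cell is again a 0-1 matrix.\<close>

lemma phi_cell: "\<phi> (cell A g g') $ h $ h' = of_bool (matched g g' h h')"
proof -
  obtain p p' where p: "matched p p' h h'"
    using matched_left_total by blast
  then have "\<phi> (cell A g g') $ h $ h' = cell A g g' $ p $ p'"
    using cell_in by (simp add: matched_def)
  moreover have "(\<forall>X\<in>A. X $ p $ p' = X $ g $ g') \<longleftrightarrow> matched g g' h h'"
    using p by (auto simp: matched_def)
  ultimately show ?thesis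
    by (simp add: cell_def)
qed

text \<open>A cell is nonzero at its own position, so by injectivity its image is nonzero.\<close>

lemma matched_right_total: "\<exists>h h'. matched g g' h h'"
proof (rule ccontr)
  assume "\<nexists>h h'. matched g g' h h'"
  then have "\<phi> (cell A g g') = 0"
    by (simp add: vec_eq_iff phi_cell)
  then have "cell A g g' = 0"
    using inj_onD[OF phi_inj _ cell_in zero_in] phi_zero by simp
  then have "cell A g g' $ g $ g' = 0"
    by simp
  then show False
    by (simp add: cell_def)
qed

section \<open>Cell sizes and intersection numbers\<close>

lemma matched_trans: "matched a b h h' \<Longrightarrow> matched a b c d \<Longrightarrow> matched g g' c d \<Longrightarrow> matched g g' h h'"
  by (simp add: matched_def)

lemma cell_eq: "matched a b c d \<Longrightarrow> cell A a b $ g $ g' = of_bool (matched g g' c d)"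
  by (simp add: cell_def matched_def)

lemma matched_transpose: "matched g g' h h' \<longleftrightarrow> matched g' g h' h"
proof -
  have "matched g' g h' h" if *: "matched g g' h h'" for g g' h h'
    unfolding matched_def
  proof
    fix X assume X: "X \<in> A"
    have "conj_transpose X $ g $ g' = \<phi> (conj_transpose X) $ h $ h'"
      using * conj_transpose_in[OF X] by (simp add: matched_def)
    then show "X $ g' $ g = \<phi> X $ h' $ h"
      unfolding phi_conj_transpose[OF X] by (simp add: conj_transpose_def)
  qed
  then show ?thesis
    by blast
qed

lemma matched_diag:
  assumes "matched g g' h h'"
  shows "g = g' \<longleftrightarrow> h = h'"
proof -
  have "(mat 1 :: complex^'m^'m) $ g $ g' = \<phi> (mat 1) $ h $ h'"
    using assms one_in unfolding matched_def by blast
  then show ?thesis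
    unfolding phi_one by (simp add: mat_def split: if_splits)
qed

text \<open>The entries of the sum of all \<open>A_i (x) B_i\<close>. Fixing the first two arguments
  gives the indicator of a \<open>B_i\<close>, fixing the last two that of the corresponding
  \<open>A_i\<close>.\<close>

definition r :: "'m \<Rightarrow> 'm \<Rightarrow> 'n \<Rightarrow> 'n \<Rightarrow> real" where
  "r g g' h h' = of_bool (matched g g' h h')"

text \<open>The number \<open>n_i\<close>, counted in \<open>B_i\<close>;
  \<open>sum_matched_left\<close> finds the same count in \<open>A_i\<close>.\<close>

definition cell_size :: "'m \<Rightarrow> 'm \<Rightarrow> real" where
  "cell_size g g' = (\<Sum>h\<in>UNIV. \<Sum>h'\<in>UNIV. r g g' h h')"

lemma r_transpose: "r g g' h h' = r g' g h' h"
  using matched_transpose by (simp add: r_def)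

lemma cell_size_transpose: "cell_size g g' = cell_size g' g"
  unfolding cell_size_def by (subst sum.swap) (simp add: r_transpose[of g g'])

lemma cell_size_pos: "0 < cell_size g g'"
proof -
  obtain h h' where "matched g g' h h'"
    using matched_right_total by blast
  then have "0 < r g g' h h'"
    by (simp add: r_def)
  also have "\<dots> \<le> (\<Sum>h'\<in>UNIV. r g g' h h')"
    by (rule member_le_sum) (auto simp: r_def)
  also have "\<dots> \<le> cell_size g g'"
    unfolding cell_size_def by (rule member_le_sum) (auto simp: r_def intro: sum_nonneg)
  finally show ?thesis .
qed

lemma sum_matched_left:
  assumes "matched g g' h h'"
  shows "(\<Sum>a\<in>UNIV. \<Sum>b\<in>UNIV. r a b h h') = cell_size g g'"
proof -
  have "complex_of_real (\<Sum>a\<in>UNIV. \<Sum>b\<in>UNIV. r a b h h') = complex_of_real (cell_size g g')"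
    using phi_sum_entries[OF cell_in[of g g']] unfolding cell_size_def
    by (simp add: r_def phi_cell cell_eq[OF assms])
  then show ?thesis
    by (simp only: of_real_eq_iff)
qed

lemma matched_cell_size: "matched g g' h h' \<Longrightarrow> matched a b h h' \<Longrightarrow> cell_size g g' = cell_size a b"
  using sum_matched_left[of g g' h h'] sum_matched_left[of a b h h'] by simp

text \<open>As \<open>\<phi>\<close> is multiplicative, corresponding cells have the same
  intersection numbers, the entries of products of two cells.\<close>

lemma sum_mult_matched:
  assumes ga: "matched g a h b" and 0: "matched a0 b0 c0 d0" and 1: "matched a1 b1 c1 d1"
  shows "(\<Sum>p\<in>UNIV. r g p c0 d0 * r p a c1 d1) = (\<Sum>q\<in>UNIV. r a0 b0 h q * r a1 b1 q b)"
proof -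
  have "(cell A a0 b0 ** cell A a1 b1) $ g $ a = (\<phi> (cell A a0 b0) ** \<phi> (cell A a1 b1)) $ h $ b"
    using ga cell_in mult_in by (simp add: matched_def flip: phi_mult)
  then have "complex_of_real (\<Sum>p\<in>UNIV. r g p c0 d0 * r p a c1 d1)
      = complex_of_real (\<Sum>q\<in>UNIV. r a0 b0 h q * r a1 b1 q b)"
    by (simp add: matrix_matrix_mult_def r_def phi_cell cell_eq[OF 0] cell_eq[OF 1] flip: of_bool_conj)
  then show ?thesis
    by (simp only: of_real_eq_iff)
qed

section \<open>The DNN matrix and its positivity\<close>

definition dnn :: "real^('m \<times> 'n)^('m \<times> 'n)" where
  "dnn = (\<chi> i j. r (fst i) (fst j) (snd i) (snd j) / cell_size (fst i) (fst j))"

lemma dnn_nth: "dnn $ (g, h) $ (g', h') = r g g' h h' / cell_size g g'"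
  by (simp add: dnn_def)

text \<open>This is \<open>(X (x) 1) M = (1 (x) phi(X)^T) M\<close> for a cell
  \<open>X = A_i\<close>. With \<open>(g, a)\<close> in \<open>A_k\<close> and \<open>(h, b)\<close>
  in \<open>B_j\<close>, both sides are \<open>T / (n_j n_k)\<close>, where \<open>T\<close> counts
  triangles with sides in \<open>B_i\<close>, \<open>B_j\<close>, \<open>B_k\<close>.\<close>

lemma dnn_intertwines:
  assumes 0: "matched a0 b0 c0 d0"
  shows "(\<Sum>p\<in>UNIV. r g p c0 d0 * dnn $ (p, h) $ (a, b)) = (\<Sum>q\<in>UNIV. r a0 b0 q h * dnn $ (g, q) $ (a, b))"
proof -
  obtain a1 b1 where 1: "matched a1 b1 h b"
    using matched_left_total by blast
  \<comment> \<open>The triangle has vertices \<open>h'\<close>, \<open>q\<close>,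
    \<open>b'\<close>. It is counted first over its side in \<open>B_k\<close>, then over its side
    in \<open>B_j\<close>.\<close>
  define T where "T = (\<Sum>h'\<in>UNIV. \<Sum>b'\<in>UNIV. \<Sum>q\<in>UNIV. r g a h' b' * (r a0 b0 h' q * r a1 b1 q b'))"
  have "r g a h' b' * (\<Sum>p\<in>UNIV. r g p c0 d0 * r p a h b)
      = (\<Sum>q\<in>UNIV. r g a h' b' * (r a0 b0 h' q * r a1 b1 q b'))" for h' b'
    using sum_mult_matched[OF _ 0 1, of g a h' b'] by (simp add: r_def sum_distrib_left)
  then have L: "cell_size g a * (\<Sum>p\<in>UNIV. r g p c0 d0 * r p a h b) = T"
    unfolding T_def cell_size_def sum_distrib_right by simp
  obtain c2 d2 where 2: "matched g a c2 d2"
    using matched_right_total by blast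
  have t0: "matched b0 a0 d0 c0"
    using 0 matched_transpose by blast
  have "r a1 b1 q b' * (\<Sum>t\<in>UNIV. r a0 b0 t h * r g a t b)
      = (\<Sum>h'\<in>UNIV. r g a h' b' * (r a0 b0 h' q * r a1 b1 q b'))" for q b'
  proof (cases "matched a1 b1 q b'")
    case True
    \<comment> \<open>Two positions of \<open>B_j\<close> are compared through their common match
      \<open>(a1, b1)\<close>; the side in \<open>B_i\<close> is traversed backwards, hence the
      transposed cell.\<close>
    have "(\<Sum>q\<in>UNIV. r b0 a0 h q * r g a q b) = (\<Sum>h'\<in>UNIV. r b0 a0 q h' * r g a h' b')"
      using sum_mult_matched[OF 1 t0 2] sum_mult_matched[OF True t0 2] by simp
    then show ?thesis
      using True by (simp add: r_transpose[of b0 a0] r_def[of a1] mult.commute)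
  qed (simp add: r_def)
  moreover have "T = (\<Sum>q\<in>UNIV. \<Sum>b'\<in>UNIV. \<Sum>h'\<in>UNIV. r g a h' b' * (r a0 b0 h' q * r a1 b1 q b'))"
    unfolding T_def by (subst sum_rotate) (intro sum.cong refl sum.swap)
  ultimately have R: "cell_size a1 b1 * (\<Sum>q\<in>UNIV. r a0 b0 q h * r g a q b) = T"
    unfolding cell_size_def sum_distrib_right by simp
  have "dnn $ (p, h) $ (a, b) = r p a h b / cell_size a1 b1" for p
    using matched_cell_size[OF 1, of p a] by (simp add: dnn_nth r_def)
  moreover have "dnn $ (g, q) $ (a, b) = r g a q b / cell_size g a" for q
    by (simp add: dnn_nth)
  moreover have "(\<Sum>p\<in>UNIV. r g p c0 d0 * r p a h b) = T / cell_size g a"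
    using L cell_size_pos[of g a] by (simp add: field_simps)
  moreover have "(\<Sum>q\<in>UNIV. r a0 b0 q h * r g a q b) = T / cell_size a1 b1"
    using R cell_size_pos[of a1 b1] by (simp add: field_simps)
  ultimately show ?thesis
    by (simp flip: sum_divide_distrib)
qed


lemma dnn_symmetric: "transpose dnn = dnn"
proof -
  have "dnn $ (g', h') $ (g, h) = dnn $ (g, h) $ (g', h')" for g h g' h'
    by (simp only: dnn_nth r_transpose[of g' g] cell_size_transpose[of g' g])
  then show ?thesis
    by (simp add: transpose_def vec_eq_iff)
qed

text \<open>The matrix \<open>1 \<otimes> \<Sum>\<^sub>i B\<^sub>i B\<^sub>i\<^sup>T / n\<^sub>i\<close>. The sum runs over positions \<open>c\<close> instead of cells; every cell
  contains \<open>n\<^sub>i\<close> positions, hence the square in the denominator.\<close>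

definition gram :: "real^('m \<times> 'n)^('m \<times> 'n)" where
  "gram = (\<chi> i j. if fst i = fst j
     then \<Sum>c\<in>UNIV. \<Sum>q\<in>UNIV. r (fst c) (snd c) (snd i) q * r (fst c) (snd c) (snd j) q
       / (cell_size (fst c) (snd c))\<^sup>2
     else 0)"

lemma gram_symmetric: "transpose gram = gram"
  by (auto simp: transpose_def gram_def vec_eq_iff mult.commute)

lemma gram_form:
  "v \<bullet> (gram *v v) = (\<Sum>g\<in>UNIV. \<Sum>c\<in>UNIV. \<Sum>q\<in>UNIV.
     (\<Sum>h\<in>UNIV. v $ (g, h) * r (fst c) (snd c) h q)\<^sup>2 / (cell_size (fst c) (snd c))\<^sup>2)"
proof -
  define t where "t c h q = r (fst c) (snd c) h q / cell_size (fst c) (snd c)" for c h q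
  have mv: "(gram *v v) $ (g, h) = (\<Sum>h'\<in>UNIV. (\<Sum>c\<in>UNIV. \<Sum>q\<in>UNIV. t c h q * t c h' q) * v $ (g, h'))"
    for g h
  proof -
    have "(gram *v v) $ (g, h) = (\<Sum>g'\<in>UNIV. \<Sum>h'\<in>UNIV. gram $ (g, h) $ (g', h') * v $ (g', h'))"
      by (simp add: matrix_vector_mult_def sum_UNIV_prod)
    also have "\<dots> = (\<Sum>h'\<in>UNIV. gram $ (g, h) $ (g, h') * v $ (g, h'))"
      by (rule sum_UNIV_single) (simp add: gram_def)
    finally show ?thesis
      by (simp add: gram_def t_def power2_eq_square)
  qed
  have "v \<bullet> (gram *v v) = (\<Sum>g\<in>UNIV. \<Sum>h\<in>UNIV. v $ (g, h) * (gram *v v) $ (g, h))"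
    by (simp add: inner_vec_def sum_UNIV_prod)
  also have "\<dots> = (\<Sum>g\<in>UNIV. \<Sum>h\<in>UNIV. \<Sum>h'\<in>UNIV. \<Sum>c\<in>UNIV. \<Sum>q\<in>UNIV.
      (v $ (g, h) * t c h q) * (v $ (g, h') * t c h' q))"
    by (simp add: mv sum_distrib_left sum_distrib_right mult_ac)
  also have "\<dots> = (\<Sum>g\<in>UNIV. \<Sum>c\<in>UNIV. \<Sum>q\<in>UNIV. \<Sum>h\<in>UNIV. \<Sum>h'\<in>UNIV.
      (v $ (g, h) * t c h q) * (v $ (g, h') * t c h' q))"
    by (intro sum.cong refl sum_reorder)
  also have "\<dots> = (\<Sum>g\<in>UNIV. \<Sum>c\<in>UNIV. \<Sum>q\<in>UNIV. (\<Sum>h\<in>UNIV. v $ (g, h) * t c h q)\<^sup>2)"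
    by (simp add: power2_eq_square sum_product)
  finally show ?thesis
    by (simp add: t_def power_divide flip: sum_divide_distrib)
qed

text \<open>The form is a sum of squares, and the cells on the diagonal alone already recover every
  entry of \<open>v\<close>.\<close>

lemma gram_pos:
  assumes "v \<noteq> 0"
  shows "0 < v \<bullet> (gram *v v)"
proof (rule ccontr)
  assume "\<not> 0 < v \<bullet> (gram *v v)"
  moreover have "0 \<le> v \<bullet> (gram *v v)"
    unfolding gram_form by (intro sum_nonneg) simp
  ultimately have "v \<bullet> (gram *v v) = 0"
    by simp
  then have 0: "(\<Sum>h\<in>UNIV. v $ (g, h) * r a b h q)\<^sup>2 / (cell_size a b)\<^sup>2 = 0" for g a b q
    unfolding gram_form by (subst (asm) sum_nonneg_eq_0_iff; simp add: sum_nonneg sum_nonneg_eq_0_iff) blast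
  have "v $ (g, q) = 0" for g q
  proof -
    obtain a b where ab: "matched a b q q"
      using matched_left_total by blast
    have "h = q" if "matched a b h q" for h
      using matched_diag[OF ab] matched_diag[OF that] by simp
    then have "(\<Sum>h\<in>UNIV. v $ (g, h) * r a b h q) = v $ (g, q) * r a b q q"
      by (intro sum_UNIV_single) (auto simp: r_def)
    then show ?thesis
      using 0[of g a b q] ab cell_size_pos[of a b] by (simp add: r_def)
  qed
  then show False
    using assms by (simp add: vec_eq_iff)
qed

text \<open>Write the left factor as the sum of \<open>(1 (x) B_i) (A_i (x) 1) / n_i\<close> and
  replace \<open>A_i (x) 1\<close> by \<open>1 (x) B_i^T\<close> in front of the right
  factor.\<close>

lemma dnn_square: "dnn ** dnn = gram ** dnn"
proof -
  \<comment> \<open>A matching position for each \<open>c\<close> lets \<open>r\<close> also express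
    the cell of \<open>c\<close> itself, not only its image.\<close>
  have "\<exists>\<pi>. \<forall>c. matched (fst c) (snd c) (fst (\<pi> c)) (snd (\<pi> c))"
    using matched_right_total by (intro choice) simp
  then obtain \<pi> where \<pi>: "\<And>c. matched (fst c) (snd c) (fst (\<pi> c)) (snd (\<pi> c))"
    by blast
  let ?w = "\<lambda>c. (cell_size (fst c) (snd c))\<^sup>2"
  define rr where "rr c h q = r (fst c) (snd c) h q" for c h q
  \<comment> \<open>Each cell occurs for \<open>n_i\<close> positions \<open>c\<close>, each with
    weight \<open>1 / n_i^2\<close>.\<close>
  have dnn_eq: "dnn $ (g, h) $ (p, q) = (\<Sum>c\<in>UNIV. r g p (fst (\<pi> c)) (snd (\<pi> c)) * rr c h q / ?w c)" for g h p q
  proof (cases "matched g p h q")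
    case True
    have "r g p (fst (\<pi> c)) (snd (\<pi> c)) * rr c h q / ?w c = r (fst c) (snd c) h q / (cell_size g p)\<^sup>2" for c
    proof (cases "matched (fst c) (snd c) h q")
      case c: True
      then show ?thesis
        using matched_trans[OF \<pi>[of c] c True] matched_cell_size[OF True c] by (simp add: rr_def r_def)
    qed (simp add: rr_def r_def)
    then have "(\<Sum>c\<in>UNIV. r g p (fst (\<pi> c)) (snd (\<pi> c)) * rr c h q / ?w c) = cell_size g p / (cell_size g p)\<^sup>2"
      by (simp add: sum_UNIV_prod sum_matched_left[OF True] flip: sum_divide_distrib)
    then show ?thesis
      using True cell_size_pos[of g p] by (simp add: dnn_nth r_def power2_eq_square)
  next
    case False
    then have "r g p (fst (\<pi> c)) (snd (\<pi> c)) * rr c h q / ?w c = 0" for c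
      using matched_trans[OF _ \<pi>[of c]] by (auto simp: rr_def r_def)
    then have "(\<Sum>c\<in>UNIV. r g p (fst (\<pi> c)) (snd (\<pi> c)) * rr c h q / ?w c) = 0"
      by (intro sum.neutral ballI)
    then show ?thesis
      using False by (simp add: dnn_nth r_def[of g p h q])
  qed
  have "(dnn ** dnn) $ (g, h) $ (a, b) = (gram ** dnn) $ (g, h) $ (a, b)" for g h a b
  proof -
    let ?d = "\<lambda>g h. dnn $ (g, h) $ (a, b)"
    have "(dnn ** dnn) $ (g, h) $ (a, b) = (\<Sum>p\<in>UNIV. \<Sum>q\<in>UNIV. dnn $ (g, h) $ (p, q) * ?d p q)"
      by (simp add: matrix_matrix_mult_def sum_UNIV_prod)
    also have "\<dots> = (\<Sum>p\<in>UNIV. \<Sum>q\<in>UNIV. \<Sum>c\<in>UNIV. rr c h q / ?w c * (r g p (fst (\<pi> c)) (snd (\<pi> c)) * ?d p q))"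
      unfolding dnn_eq[of g h] sum_distrib_right by (simp add: mult_ac)
    also have "\<dots> = (\<Sum>c\<in>UNIV. \<Sum>q\<in>UNIV. \<Sum>p\<in>UNIV. rr c h q / ?w c * (r g p (fst (\<pi> c)) (snd (\<pi> c)) * ?d p q))"
      by (subst sum_rotate) (intro sum.cong refl sum.swap)
    \<comment> \<open>The intertwining identity trades \<open>A_i\<close> at \<open>g\<close> for
      the transpose of \<open>B_i\<close> at \<open>q\<close>.\<close>
    also have "\<dots> = (\<Sum>c\<in>UNIV. \<Sum>q\<in>UNIV. rr c h q / ?w c * (\<Sum>t\<in>UNIV. rr c t q * ?d g t))"
      by (simp only: rr_def dnn_intertwines[OF \<pi>] flip: sum_distrib_left)
    also have "\<dots> = (\<Sum>c\<in>UNIV. \<Sum>q\<in>UNIV. \<Sum>t\<in>UNIV. rr c h q * rr c t q / ?w c * ?d g t)"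
      by (simp add: sum_distrib_left mult_ac)
    also have "\<dots> = (\<Sum>t\<in>UNIV. (\<Sum>c\<in>UNIV. \<Sum>q\<in>UNIV. rr c h q * rr c t q / ?w c) * ?d g t)"
      unfolding sum_distrib_right by (rule sum_rotate)
    also have "\<dots> = (\<Sum>t\<in>UNIV. gram $ (g, h) $ (g, t) * ?d g t)"
      by (simp add: gram_def rr_def)
    also have "\<dots> = (\<Sum>p\<in>UNIV. \<Sum>t\<in>UNIV. gram $ (g, h) $ (p, t) * ?d p t)"
      by (rule sum_UNIV_single[symmetric]) (simp add: gram_def)
    also have "\<dots> = (gram ** dnn) $ (g, h) $ (a, b)"
      by (simp add: matrix_matrix_mult_def sum_UNIV_prod)
    finally show ?thesis .
  qed
  then show ?thesis
    by (simp add: vec_eq_iff)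
qed

lemma pos_semidef_dnn: "pos_semidef dnn"
  using dnn_symmetric gram_symmetric dnn_square gram_pos by (rule pos_semidef_if_square_eq_mult)

section \<open>Zero pattern and sums of the DNN matrix\<close>

lemma matched_rel:
  assumes AG: "adj_matrix G \<in> A" and AH: "\<phi> (adj_matrix G) = adj_matrix H" and "matched g g' h h'"
  shows "rel G g g' = rel H h h'"
proof -
  have "adj_matrix G $ g $ g' = adj_matrix H $ h $ h'"
    using assms unfolding matched_def by metis
  then have "G g g' \<longleftrightarrow> H h h'"
    by (simp add: adj_matrix_def split: if_splits)
  then show ?thesis
    using matched_diag[OF assms(3)] by (simp add: rel_def)
qed

lemma dnn_isomorphic_if_adj_matrix:
  assumes "adj_matrix G \<in> A" "\<phi> (adj_matrix G) = adj_matrix H"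
  shows "dnn_isomorphic G H"
  unfolding dnn_isomorphic_def
proof (intro exI conjI allI impI)
  show "dnn \<in> doubly_nonneg"
    using pos_semidef_dnn cell_size_pos
    by (simp add: doubly_nonneg_def dnn_def r_def less_imp_le)
  show "(\<Sum>h\<in>UNIV. \<Sum>h'\<in>UNIV. dnn $ (g, h) $ (g', h')) = 1" for g g'
    using cell_size_pos[of g g'] by (simp add: dnn_nth flip: sum_divide_distrib cell_size_def)
  show "(\<Sum>g\<in>UNIV. \<Sum>g'\<in>UNIV. dnn $ (g, h) $ (g', h')) = 1" for h h'
  proof -
    obtain a b where ab: "matched a b h h'"
      using matched_left_total by blast
    \<comment> \<open>All positions matching \<open>(h, h')\<close> lie in one cell, so the nonzero
      terms share a denominator.\<close>
    have "dnn $ (g, h) $ (g', h') = r g g' h h' / cell_size a b" for g g'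
      using matched_cell_size[OF ab, of g g'] by (simp add: dnn_nth r_def)
    then show ?thesis
      using cell_size_pos[of a b] sum_matched_left[OF ab] by (simp flip: sum_divide_distrib)
  qed
  show "dnn $ (g, h) $ (g', h') = 0" if "rel G g g' \<noteq> rel H h h'" for g h g' h'
    using matched_rel[OF assms] that by (auto simp: dnn_nth r_def)
qed

end

theorem mainTheorem2:
  fixes G :: "'g::finite \<Rightarrow> 'g \<Rightarrow> bool" and H :: "'h::finite \<Rightarrow> 'h \<Rightarrow> bool"
  assumes "simple_graph G" and "simple_graph H"
  shows "dnn_isomorphic G H \<longleftrightarrow>
    (\<exists>\<phi>. coherent_algebra_iso (graph_coherent_algebra G) (graph_coherent_algebra H) \<phi> \<and>
         \<phi> (adj_matrix G) = adj_matrix H)"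
proof
  assume "dnn_isomorphic G H"
  then obtain M :: "real^('g \<times> 'h)^('g \<times> 'h)" where M: "M \<in> doubly_nonneg"
    "\<And>g g'. (\<Sum>h\<in>UNIV. \<Sum>h'\<in>UNIV. M $ (g, h) $ (g', h')) = 1"
    "\<And>h h'. (\<Sum>g\<in>UNIV. \<Sum>g'\<in>UNIV. M $ (g, h) $ (g', h')) = 1"
    and rel: "\<And>g h g' h'. M $ (g, h) $ (g', h') \<noteq> 0 \<Longrightarrow> rel G g g' = rel H h h'"
    unfolding dnn_isomorphic_def by blast
  interpret dnn_isomorphism M
  proof
    show "M $ (g, h) $ (g', h') \<noteq> 0 \<Longrightarrow> g = g' \<longleftrightarrow> h = h'" for g h g' h'
      using rel[of g h g' h'] by (auto simp: rel_def split: if_splits)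
    show "pos_semidef M" "0 \<le> M $ i $ j" for i j
      using M(1) by (auto simp: doubly_nonneg_def simp del: split_paired_All)
  qed (fact M(2) M(3))+
  \<comment> \<open>In the case \<open>Equal\<close>, irreflexivity makes both sides false.\<close>
  have "G g g' \<longleftrightarrow> H h h'" if "M $ (g, h) $ (g', h') \<noteq> 0" for g h g' h'
    using rel[OF that] assms by (auto simp: rel_def simple_graph_def irreflp_def split: if_splits)
  then have "linked_matrices (adj_matrix G) (adj_matrix H)"
    by (simp add: linked_matrices_def linked_def adj_matrix_def)
  then show "\<exists>\<phi>. coherent_algebra_iso (graph_coherent_algebra G) (graph_coherent_algebra H) \<phi> \<and>
         \<phi> (adj_matrix G) = adj_matrix H"
    by (rule coherent_algebra_iso_of_linked)
next
  assume "\<exists>\<phi>. coherent_algebra_iso (graph_coherent_algebra G) (graph_coherent_algebra H) \<phi> \<and>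
         \<phi> (adj_matrix G) = adj_matrix H"
  then obtain \<phi> where \<phi>: "coherent_algebra_iso (graph_coherent_algebra G) (graph_coherent_algebra H) \<phi>"
    and adj: "\<phi> (adj_matrix G) = adj_matrix H"
    by blast
  interpret coherent_algebra_isomorphism "graph_coherent_algebra G" "graph_coherent_algebra H" \<phi>
    by unfold_locales (use \<phi> coherent_graph_coherent_algebra in auto)
  show "dnn_isomorphic G H"
    using adj_matrix_in_graph_coherent_algebra adj by (rule dnn_isomorphic_if_adj_matrix)
qed

end
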